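(* Let $\mathbb{F}$ be a real-closed field and let $n \geq 3$ be an odd positive integer. If $\vert \mathrm{Aut}(\mathbb{F})\vert < \vert\mathbb{F}\vert$, then $\mathbf{PG}(n-1,\mathbb{F})$ cannot admit Singer groups. In particular, $\mathbf{PG}(2,\mathbb{R})$ has no Singer groups.
   Context: $\vert\cdot\vert$ denotes cardinality and $\mathrm{Aut}(\mathbb{F})$ is the group of field automorphisms of $\mathbb{F}$. $\mathbf{PG}(n-1,\mathbb{F})$ is the projective space of the vector space $\mathbb{F}^n$; its points are the $1$-dimensional subspaces, and its automorphism group is $\mathbf{P\Gamma L}_n(\mathbb{F})$ (semilinear bijections modulo scalars). A Singer group is a subgroup of this automorphism group acting sharply transitively on the points (for any two points $x,y$ there is exactly one group element mapping $x$ to $y$). *)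

theory Defs
  imports "HOL-Analysis.Analysis" "HOL-Algebra.Coset" "HOL-Computational_Algebra.Polynomial"
begin

(* The order is existentially quantified because being real-closed is a property of the bare
   field; an order as required here is unique (its nonnegative elements are the squares). *)
definition real_closed :: "'a::field itself \<Rightarrow> bool" where
  "real_closed _ \<longleftrightarrow>
     (\<exists>le :: 'a \<Rightarrow> 'a \<Rightarrow> bool.
        class.linorder le (\<lambda>x y. le x y \<and> \<not> le y x) \<and>
        (\<forall>x y z. le x y \<longrightarrow> le (x + z) (y + z)) \<and>
        (\<forall>x y. le 0 x \<longrightarrow> le 0 y \<longrightarrow> le 0 (x * y)) \<and>
        (\<forall>x. le 0 x \<longrightarrow> (\<exists>y. x = y ^ 2)) \<and>
        (\<forall>p :: 'a poly. odd (degree p) \<longrightarrow> (\<exists>x. poly p x = 0)))"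

definition field_automorphisms :: "('a::field \<Rightarrow> 'a) set" where
  "field_automorphisms =
     {\<sigma>. bij \<sigma> \<and> \<sigma> 0 = 0 \<and> \<sigma> 1 = 1 \<and>
          (\<forall>x y. \<sigma> (x + y) = \<sigma> x + \<sigma> y) \<and> (\<forall>x y. \<sigma> (x * y) = \<sigma> x * \<sigma> y)}"

definition PG_points :: "('a::field ^ 'n) set set" where
  "PG_points = {P. vec.subspace P \<and> vec.dim P = 1}"

definition GammaL :: "('a::field ^ 'n \<Rightarrow> 'a ^ 'n) monoid" where
  "GammaL =
     \<lparr>carrier = {f. bij f \<and> (\<forall>u v. f (u + v) = f u + f v) \<and>
                     (\<exists>\<sigma>\<in>field_automorphisms. \<forall>c v. f (c *s v) = \<sigma> c *s f v)},
      mult = (\<circ>), one = id\<rparr>"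

definition nonzero_scalars :: "('a::field ^ 'n \<Rightarrow> 'a ^ 'n) set" where
  "nonzero_scalars = {(\<lambda>v. c *s v) | c. c \<noteq> 0}"

definition PGammaL :: "('a::field ^ 'n \<Rightarrow> 'a ^ 'n) set monoid" where
  "PGammaL = GammaL Mod nonzero_scalars"

(* An element of PGammaL is a coset of semilinear bijections. All its members map a point P to
   the same point (PGammaL_act_eq below), so this union is just the image of P. *)
definition PGammaL_act ::
    "('a::field ^ 'n \<Rightarrow> 'a ^ 'n) set \<Rightarrow> ('a ^ 'n) set \<Rightarrow> ('a ^ 'n) set" where
  "PGammaL_act g P = (\<Union>f\<in>g. f ` P)"

definition singer_group :: "('a::field ^ 'n \<Rightarrow> 'a ^ 'n) set set \<Rightarrow> bool" where
  "singer_group S \<longleftrightarrow>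
     subgroup S PGammaL \<and>
     (\<forall>P\<in>PG_points. \<forall>Q\<in>PG_points. \<exists>!g. g \<in> S \<and> PGammaL_act g P = Q)"

lemma field_automorphisms_id: "id \<in> field_automorphisms"
  by (simp add: field_automorphisms_def)

lemma field_automorphisms_comp:
  "\<sigma> \<in> field_automorphisms \<Longrightarrow> \<tau> \<in> field_automorphisms \<Longrightarrow> \<sigma> \<circ> \<tau> \<in> field_automorphisms"
  by (auto simp: field_automorphisms_def intro: bij_comp)

lemma field_automorphisms_inv:
  assumes "\<sigma> \<in> field_automorphisms"
  shows "inv_into UNIV \<sigma> \<in> field_automorphisms"
proof -
  from assms have b: "bij \<sigma>" by (simp add: field_automorphisms_def)
  have eqI: "inv_into UNIV \<sigma> y = x" if "\<sigma> x = y" for x y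
    using b that by (auto simp: bij_is_inj)
  have s: "\<sigma> (inv_into UNIV \<sigma> x) = x" for x using b by (simp add: bij_is_surj surj_f_inv_f)
  show ?thesis
    using assms bij_imp_bij_inv[OF b]
    by (auto simp: field_automorphisms_def s intro!: eqI)
qed

lemma GammaL_I:
  assumes "bij f" "\<And>u v. f (u + v) = f u + f v"
    and "\<sigma> \<in> field_automorphisms" "\<And>c v. f (c *s v) = \<sigma> c *s f v"
  shows "f \<in> carrier GammaL"
  using assms by (auto simp: GammaL_def intro!: bexI[of _ \<sigma>])

lemma group_GammaL: "group (GammaL :: ('a::field ^ 'n \<Rightarrow> 'a ^ 'n) monoid)"
proof (rule groupI)
  fix f g :: "'a ^ 'n \<Rightarrow> 'a ^ 'n"
  assume f: "f \<in> carrier GammaL" and g: "g \<in> carrier GammaL"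
  then obtain \<sigma> \<tau> where \<sigma>: "\<sigma> \<in> field_automorphisms" "\<forall>c v. f (c *s v) = \<sigma> c *s f v"
    and \<tau>: "\<tau> \<in> field_automorphisms" "\<forall>c v. g (c *s v) = \<tau> c *s g v"
    by (auto simp: GammaL_def)
  have "f \<circ> g \<in> carrier GammaL"
  proof (rule GammaL_I)
    show "bij (f \<circ> g)" using f g by (auto simp: GammaL_def intro: bij_comp)
    show "(f \<circ> g) (u + v) = (f \<circ> g) u + (f \<circ> g) v" for u v
      using f g by (simp add: GammaL_def)
    show "(f \<circ> g) (c *s v) = (\<sigma> \<circ> \<tau>) c *s (f \<circ> g) v" for c v
      using \<sigma>(2) \<tau>(2) by simp
  qed (rule field_automorphisms_comp[OF \<sigma>(1) \<tau>(1)])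
  then show "f \<otimes>\<^bsub>GammaL\<^esub> g \<in> carrier GammaL" by (simp add: GammaL_def)
next
  have "id \<in> carrier (GammaL :: ('a ^ 'n \<Rightarrow> 'a ^ 'n) monoid)"
    by (rule GammaL_I[OF _ _ field_automorphisms_id]) simp_all
  then show "\<one>\<^bsub>GammaL\<^esub> \<in> carrier (GammaL :: ('a ^ 'n \<Rightarrow> 'a ^ 'n) monoid)"
    by (simp add: GammaL_def)
next
  fix f :: "'a ^ 'n \<Rightarrow> 'a ^ 'n"
  assume f: "f \<in> carrier GammaL"
  then obtain \<sigma> where \<sigma>: "\<sigma> \<in> field_automorphisms" "\<And>c v. f (c *s v) = \<sigma> c *s f v"
    and b: "bij f" and add: "\<And>u v. f (u + v) = f u + f v"
    by (auto simp: GammaL_def)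
  have eqI: "inv_into UNIV f y = x" if "f x = y" for x y
    using b that by (auto simp: bij_is_inj)
  have s: "f (inv_into UNIV f x) = x" for x using b by (simp add: bij_is_surj surj_f_inv_f)
  have t: "\<sigma> (inv_into UNIV \<sigma> x) = x" for x
    using \<sigma>(1) by (simp add: field_automorphisms_def bij_is_surj surj_f_inv_f)
  have "inv_into UNIV f \<in> carrier GammaL"
    by (rule GammaL_I[OF bij_imp_bij_inv[OF b] _ field_automorphisms_inv[OF \<sigma>(1)]])
      (rule eqI, simp add: \<sigma>(2) add s t)+
  moreover have "inv_into UNIV f \<otimes>\<^bsub>GammaL\<^esub> f = \<one>\<^bsub>GammaL\<^esub>"
    using b by (simp add: GammaL_def bij_is_inj)
  ultimately show "\<exists>g\<in>carrier GammaL. g \<otimes>\<^bsub>GammaL\<^esub> f = \<one>\<^bsub>GammaL\<^esub>"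
    by blast
qed (auto simp: GammaL_def)

lemma nonzero_scalars_subset: "nonzero_scalars \<subseteq> carrier GammaL"
proof
  fix h :: "'a::field ^ 'n \<Rightarrow> 'a ^ 'n"
  assume "h \<in> nonzero_scalars"
  then obtain c where c: "c \<noteq> 0" "h = (\<lambda>v. c *s v)" by (auto simp: nonzero_scalars_def)
  have "bij h"
    unfolding c(2) using c(1)
    by (intro o_bij[where g = "\<lambda>v. inverse c *s v"]) (auto simp: fun_eq_iff)
  then show "h \<in> carrier GammaL"
    by (rule GammaL_I[OF _ _ field_automorphisms_id])
      (simp_all add: c vector_add_ldistrib mult.commute)
qed

lemma normal_nonzero_scalars:
  "nonzero_scalars \<lhd> (GammaL :: ('a::field ^ 'n \<Rightarrow> 'a ^ 'n) monoid)"
proof -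
  interpret group "GammaL :: ('a ^ 'n \<Rightarrow> 'a ^ 'n) monoid" by (rule group_GammaL)
  have comp: "f \<circ> g \<in> nonzero_scalars"
    if "f \<in> nonzero_scalars" "g \<in> nonzero_scalars" for f g :: "'a ^ 'n \<Rightarrow> 'a ^ 'n"
  proof -
    from that obtain c d where "c \<noteq> 0" "d \<noteq> 0" "f = (\<lambda>v. c *s v)" "g = (\<lambda>v. d *s v)"
      by (auto simp: nonzero_scalars_def)
    then show ?thesis
      by (auto simp: nonzero_scalars_def fun_eq_iff intro!: exI[of _ "c * d"])
  qed
  have inv_in: "inv\<^bsub>GammaL\<^esub> f \<in> nonzero_scalars"
    if "f \<in> nonzero_scalars" for f :: "'a ^ 'n \<Rightarrow> 'a ^ 'n"
  proof -
    from that obtain c where c: "c \<noteq> 0" "f = (\<lambda>v. c *s v)"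
      by (auto simp: nonzero_scalars_def)
    let ?g = "\<lambda>v :: 'a ^ 'n. inverse c *s v"
    have g: "?g \<in> nonzero_scalars"
      using c(1) by (auto simp: nonzero_scalars_def intro!: exI[of _ "inverse c"])
    have "?g \<otimes>\<^bsub>GammaL\<^esub> f = \<one>\<^bsub>GammaL\<^esub>"
      using c by (simp add: GammaL_def fun_eq_iff)
    moreover have "f \<in> carrier GammaL" "?g \<in> carrier GammaL"
      by (rule subsetD[OF nonzero_scalars_subset that], rule subsetD[OF nonzero_scalars_subset g])
    ultimately have "inv\<^bsub>GammaL\<^esub> f = ?g" by (rule inv_equality)
    with g show ?thesis by simp
  qed
  have one: "id \<in> (nonzero_scalars :: ('a ^ 'n \<Rightarrow> 'a ^ 'n) set)"
    by (auto simp: nonzero_scalars_def fun_eq_iff intro!: exI[of _ 1])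
  have sub: "subgroup nonzero_scalars (GammaL :: ('a ^ 'n \<Rightarrow> 'a ^ 'n) monoid)"
  proof (rule subgroup.intro)
    show "f \<otimes>\<^bsub>GammaL\<^esub> g \<in> nonzero_scalars"
      if "f \<in> nonzero_scalars" "g \<in> nonzero_scalars" for f g :: "'a ^ 'n \<Rightarrow> 'a ^ 'n"
      using comp[OF that] by (simp add: GammaL_def)
    show "\<one>\<^bsub>GammaL\<^esub> \<in> (nonzero_scalars :: ('a ^ 'n \<Rightarrow> 'a ^ 'n) set)"
      using one by (simp add: GammaL_def)
  qed (rule nonzero_scalars_subset, rule inv_in)
  show ?thesis
  proof (rule normal_invI[OF sub])
    fix f h :: "'a ^ 'n \<Rightarrow> 'a ^ 'n"
    assume f: "f \<in> carrier GammaL" and h: "h \<in> nonzero_scalars"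
    then obtain c \<sigma> where c: "c \<noteq> 0" "h = (\<lambda>v. c *s v)"
      and \<sigma>: "\<sigma> \<in> field_automorphisms" "\<And>c v. f (c *s v) = \<sigma> c *s f v"
      by (auto simp: nonzero_scalars_def GammaL_def)
    let ?k = "\<lambda>v :: 'a ^ 'n. \<sigma> c *s v"
    have "\<sigma> c \<noteq> 0"
      using c(1) \<sigma>(1) by (auto simp: field_automorphisms_def bij_def dest: injD[where y = 0])
    then have k: "?k \<in> nonzero_scalars" by (auto simp: nonzero_scalars_def)
    have "f \<otimes>\<^bsub>GammaL\<^esub> h = ?k \<otimes>\<^bsub>GammaL\<^esub> f"
      by (simp add: GammaL_def fun_eq_iff c \<sigma>)
    moreover have "?k \<in> carrier GammaL"
      by (rule subsetD[OF nonzero_scalars_subset k])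
    ultimately have "f \<otimes>\<^bsub>GammaL\<^esub> h \<otimes>\<^bsub>GammaL\<^esub> inv\<^bsub>GammaL\<^esub> f = ?k"
      using f by (simp only: m_assoc r_inv r_one inv_closed)
    with k show "f \<otimes>\<^bsub>GammaL\<^esub> h \<otimes>\<^bsub>GammaL\<^esub> inv\<^bsub>GammaL\<^esub> f \<in> nonzero_scalars" by simp
  qed
qed

lemma group_PGammaL: "group (PGammaL :: ('a::field ^ 'n \<Rightarrow> 'a ^ 'n) set monoid)"
  unfolding PGammaL_def by (rule normal.factorgroup_is_group[OF normal_nonzero_scalars])

lemma PGammaL_act_eq:
  assumes g: "g \<in> carrier PGammaL" and f: "f \<in> g" and P: "vec.subspace P"
  shows "PGammaL_act g P = f ` P"
proof -
  have scalar_image: "h ` P = P" if "h \<in> nonzero_scalars" for h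
  proof -
    from that obtain c where c: "c \<noteq> 0" "h = (\<lambda>v. c *s v)" by (auto simp: nonzero_scalars_def)
    have "v \<in> h ` P" if "v \<in> P" for v
    proof (rule image_eqI)
      show "v = h (inverse c *s v)" using c by simp
      show "inverse c *s v \<in> P" using P that by (rule vec.subspace_scale)
    qed
    then show ?thesis using P c(2) by (auto intro: vec.subspace_scale)
  qed
  obtain f0 where f0: "f0 \<in> carrier GammaL" "g = nonzero_scalars #>\<^bsub>GammaL\<^esub> f0"
    using g by (auto simp: PGammaL_def FactGroup_def RCOSETS_def)
  have g': "g = (\<lambda>h. h \<circ> f0) ` nonzero_scalars"
    by (auto simp: f0(2) r_coset_def GammaL_def)
  obtain \<sigma> where \<sigma>: "\<sigma> \<in> field_automorphisms" "\<And>c v. f0 (c *s v) = \<sigma> c *s f0 v"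
    using f0(1) by (auto simp: GammaL_def)
  have "(h \<circ> f0) ` P = f0 ` P" if "h \<in> nonzero_scalars" for h
  proof -
    from that obtain c where c: "c \<noteq> 0" "h = (\<lambda>v. c *s v)" by (auto simp: nonzero_scalars_def)
    have surj: "surj \<sigma>" and \<sigma>0: "\<sigma> 0 = 0"
      using \<sigma>(1) by (auto simp: field_automorphisms_def bij_def)
    then obtain d where d: "c = \<sigma> d" by (metis surjD)
    then have "d \<noteq> 0" using c(1) \<sigma>0 by auto
    then have "(\<lambda>v. d *s v) ` P = P"
      by (intro scalar_image) (auto simp: nonzero_scalars_def)
    moreover have "h \<circ> f0 = f0 \<circ> (\<lambda>v. d *s v)" by (simp add: fun_eq_iff c d \<sigma>)
    ultimately show ?thesis by (metis image_comp)
  qed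
  then have *: "k ` P = f0 ` P" if "k \<in> g" for k using that unfolding g' by blast
  then have "(\<Union>k\<in>g. k ` P) = (\<Union>k\<in>g. f0 ` P)" by (intro SUP_cong) auto
  also have "\<dots> = f ` P" using f *[OF f] by auto
  finally show ?thesis by (simp add: PGammaL_act_def)
qed

end

theory Submission
  imports Defs
begin

text \<open>
  Two ideas are played against each other. On the one hand, a linear map of \<open>F\<^sup>n\<close> with \<open>n\<close> odd has
  an eigenvector as soon as odd-degree polynomials over \<open>F\<close> have roots: its characteristic
  polynomial has degree \<open>n\<close>. On the other hand, in a Singer group two elements that agree on a
  single point are equal. If two elements of a Singer group are induced by semilinear maps \<open>f\<close>
  and \<open>k\<close> with the same accompanying field automorphism, then \<open>f\<inverse> \<circ> k\<close> is linear, so it has an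
  eigenvector, and \<open>f\<close> and \<open>k\<close> agree on the point spanned by it; hence the two elements coincide.
  So a Singer group embeds, as a set, into \<open>Aut F\<close> (lemma
  \<open>singer_group_lepoll_field_automorphisms\<close>). Being transitive on the points, it has at least as
  many elements as there are points on a line, that is, at least \<open>|F|\<close>
  (lemma \<open>UNIV_lepoll_singer_group\<close>). Therefore \<open>|F| \<le> |Aut F|\<close>.

  For the real numbers the intermediate value theorem provides the roots, and the only
  automorphism is the identity, since automorphisms preserve squares and hence the order.
\<close>

section \<open>Eigenvectors in odd dimension\<close>

definition charpoly :: "'a::field ^ 'n ^ 'n \<Rightarrow> 'a poly" where
  "charpoly A = det (\<chi> i j. [: - A $ i $ j, if i = j then 1 else 0 :])"

lemma poly_charpoly: "poly (charpoly A) x = det (mat x - A)"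
  unfolding charpoly_def det_def
  by (simp add: poly_sum poly_prod mat_def if_distrib[where f = "\<lambda>t. _ + t"]
      if_distrib[where f = "\<lambda>t. _ * t"])
    (intro sum.cong arg_cong2[where f = "(*)"] prod.cong; simp)

text \<open>
  In the Leibniz expansion only the identity permutation picks the entry containing the
  indeterminate from every row. Every other permutation moves some index, so its product has
  degree less than \<open>n\<close>, and the leading term of the diagonal product survives.
\<close>

lemma degree_charpoly:
  fixes A :: "'a::field ^ 'n ^ 'n"
  shows "degree (charpoly A) = CARD('n)"
proof -
  define c where "c i j = [: - A $ i $ j, if i = j then 1 else 0 :]" for i j :: 'n
  define t where "t p = of_int (sign p) * (\<Prod>i\<in>UNIV. c i (p i))" for p :: "'n \<Rightarrow> 'n"
  have pos: "0 < CARD('n)" by simp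
  have deg_c: "degree (c i j) = (if i = j then 1 else 0)" for i j
    by (simp add: c_def)
  have id_term: "degree (t id) = CARD('n)"
  proof -
    have "degree (\<Prod>i\<in>UNIV. c i i) = (\<Sum>i\<in>UNIV. degree (c i i))"
      by (intro degree_prod_eq_sum_degree) (simp add: c_def)
    then show ?thesis by (simp add: t_def sign_id deg_c)
  qed
  have other: "degree (t p) < CARD('n)" if "p \<noteq> id" for p
  proof -
    from that obtain i0 where i0: "p i0 \<noteq> i0" by (auto simp: fun_eq_iff)
    have "degree (t p) \<le> degree (\<Prod>i\<in>UNIV. c i (p i))"
      by (cases p rule: sign_cases) (simp_all add: t_def)
    also have "\<dots> \<le> (\<Sum>i\<in>UNIV. degree (c i (p i)))"
      using degree_prod_sum_le[of UNIV "\<lambda>i. c i (p i)"] by (simp add: o_def)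
    also have "\<dots> < (\<Sum>i\<in>(UNIV :: 'n set). 1)"
      using i0 by (intro sum_strict_mono_ex1) (auto simp: deg_c intro!: exI[of _ i0])
    finally show ?thesis by simp
  qed
  let ?P = "{p. p permutes (UNIV :: 'n set)}"
  have "charpoly A = sum t ?P"
    by (simp add: charpoly_def det_def t_def c_def)
  also have "\<dots> = t id + sum t (?P - {id})"
    by (intro sum.remove finite_permutations) (simp_all add: permutes_id)
  finally have eq: "charpoly A = t id + sum t (?P - {id})" .
  have "degree (sum t (?P - {id})) < CARD('n)"
    using other pos by (intro degree_sum_less) auto
  then show ?thesis
    unfolding eq using id_term by (simp add: degree_add_eq_left)
qed

lemma linear_has_eigenvector:
  fixes h :: "'a::field ^ 'n \<Rightarrow> 'a ^ 'n"
  assumes roots: "\<And>p :: 'a poly. odd (degree p) \<Longrightarrow> \<exists>x. poly p x = 0"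
    and odd: "odd CARD('n)"
    and lin: "Vector_Spaces.linear (*s) (*s) h"
  obtains c v where "v \<noteq> 0" "h v = c *s v"
proof -
  obtain c where "poly (charpoly (matrix h)) c = 0"
    using roots[of "charpoly (matrix h)"] odd by (auto simp: degree_charpoly)
  then have "\<not> invertible (mat c - matrix h)"
    by (simp add: poly_charpoly invertible_det_nz)
  then obtain v where v: "v \<noteq> 0" "(mat c - matrix h) *v v = 0"
    by (auto simp: invertible_left_inverse matrix_left_invertible_ker)
  have "mat c *v v = c *s v"
    by (simp add: vec_eq_iff matrix_vector_mult_def mat_def if_distrib[where f = "\<lambda>t. t * _"]
        sum.delta cong: if_cong)
  with v(2) have "h v = c *s v"
    by (simp add: matrix_vector_mult_diff_rdistrib matrix_works[OF lin])
  with v(1) show ?thesis by (rule that)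
qed

section \<open>Singer groups and field automorphisms\<close>

lemma PG_points_span:
  assumes "v \<noteq> 0"
  shows "vec.span {v} \<in> PG_points"
  using assms vec.dim_span_eq_card_independent[of "{v}"]
  by (simp add: PG_points_def vec.subspace_span)

text \<open>
  Because both maps twist scalars by the same automorphism, the twists cancel in \<open>f\<inverse> \<circ> k\<close>, which is
  therefore linear. On the line spanned by an eigenvector of it, \<open>f\<close> and \<open>k\<close> have the same image.
\<close>

lemma semilinear_agree_on_point:
  fixes f k :: "'a::field ^ 'n \<Rightarrow> 'a ^ 'n"
  assumes roots: "\<And>p :: 'a poly. odd (degree p) \<Longrightarrow> \<exists>x. poly p x = 0"
    and odd: "odd CARD('n)"
    and f: "bij f" "\<And>u v. f (u + v) = f u + f v" "\<And>c v. f (c *s v) = \<sigma> c *s f v"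
    and k: "inj k" "\<And>u v. k (u + v) = k u + k v" "\<And>c v. k (c *s v) = \<sigma> c *s k v"
  obtains P where "P \<in> PG_points" "f ` P = k ` P"
proof -
  define h where "h = inv_into UNIV f \<circ> k"
  have fh: "f (h v) = k v" for v
    using f(1) by (simp add: h_def bij_is_surj surj_f_inv_f)
  have inj: "f x = f y \<Longrightarrow> x = y" for x y
    using f(1) by (meson bij_is_inj injD)
  have add: "h (u + v) = h u + h v" for u v
    by (rule inj) (simp add: fh f(2) k(2))
  have scale: "h (c *s v) = c *s h v" for c v
    by (rule inj) (simp add: fh f(3) k(3))
  have lin: "Vector_Spaces.linear (*s) (*s) h"
    by unfold_locales (simp_all add: add scale vec.scale_right_distrib vec.scale_left_distrib)
  obtain c v where v: "v \<noteq> 0" "h v = c *s v"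
    by (rule linear_has_eigenvector[OF roots odd lin])
  have h0: "h 0 = 0" using scale[of 0 0] by simp
  have "inj h"
  proof (rule injI)
    fix x y assume "h x = h y"
    then have "k x = k y" by (metis fh)
    then show "x = y" by (rule injD[OF k(1)])
  qed
  have "c \<noteq> 0"
  proof
    assume "c = 0"
    then have "h v = h 0" using v(2) by (simp add: h0)
    then have "v = 0" by (rule injD[OF \<open>inj h\<close>])
    with v(1) show False ..
  qed
  let ?P = "vec.span {v}"
  have "h ` ?P = range (\<lambda>d. (d * c) *s v)"
    by (simp add: vec.span_singleton image_image scale v(2))
  also have "\<dots> = (\<lambda>d. d *s v) ` range (\<lambda>d. d * c)"
    by (simp add: image_image)
  also have "range (\<lambda>d. d * c) = UNIV"
    using \<open>c \<noteq> 0\<close> by (intro surjI[where f = "\<lambda>d. d / c"]) simp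
  finally have "h ` ?P = ?P" by (simp only: vec.span_singleton)
  then have "f ` ?P = (f \<circ> h) ` ?P" by (simp only: image_comp [symmetric])
  also have "f \<circ> h = k" by (simp add: fun_eq_iff fh)
  finally show ?thesis using PG_points_span[OF v(1)] that by blast
qed

lemma PGammaL_representative:
  fixes g :: "('a::field ^ 'n \<Rightarrow> 'a ^ 'n) set"
  assumes "g \<in> carrier PGammaL"
  obtains f \<sigma> where "f \<in> g" "bij f" "\<And>u v. f (u + v) = f u + f v"
    "\<sigma> \<in> field_automorphisms" "\<And>c v. f (c *s v) = \<sigma> c *s f v"
proof -
  obtain f where f: "f \<in> carrier GammaL" "g = nonzero_scalars #>\<^bsub>GammaL\<^esub> f"
    using assms by (auto simp: PGammaL_def FactGroup_def RCOSETS_def)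
  have "f \<in> g"
    unfolding f(2)
    by (rule group.rcos_self[OF group_GammaL f(1)
          normal_imp_subgroup[OF normal_nonzero_scalars]])
  with f(1) show ?thesis by (auto simp: GammaL_def intro: that)
qed

lemma singer_group_carrier: "singer_group S \<Longrightarrow> g \<in> S \<Longrightarrow> g \<in> carrier PGammaL"
  by (auto simp: singer_group_def dest: subgroup.subset)

lemma singer_group_unique:
  assumes "singer_group S" "g \<in> S" "g' \<in> S" "P \<in> PG_points" "PGammaL_act g P \<in> PG_points"
    "PGammaL_act g P = PGammaL_act g' P"
  shows "g = g'"
  using assms unfolding singer_group_def by metis

lemma semilinear_image_point:
  fixes f :: "'a::field ^ 'n \<Rightarrow> 'a ^ 'n"
  assumes f: "inj f" "\<And>c v. f (c *s v) = \<sigma> c *s f v"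
    and \<sigma>: "\<sigma> \<in> field_automorphisms" and P: "P \<in> PG_points"
  shows "f ` P \<in> PG_points"
proof -
  from P have sub: "vec.subspace P" and dim: "vec.dim P = 1"
    by (auto simp: PG_points_def)
  obtain B where B: "B \<subseteq> P" "vec.independent B" "P \<subseteq> vec.span B" "card B = vec.dim P"
    using vec.basis_exists by blast
  then obtain v where v: "B = {v}" using dim by (auto simp: card_1_singleton_iff)
  with B have "v \<noteq> 0" by auto
  have P_eq: "P = vec.span {v}"
    using B v sub by (metis subset_antisym vec.span_minimal)
  have "\<sigma> 0 = 0" "surj \<sigma>"
    using \<sigma> by (auto simp: field_automorphisms_def bij_is_surj)
  have "f 0 = 0" using f(2)[of 0 0] \<open>\<sigma> 0 = 0\<close> by simp
  with f(1) \<open>v \<noteq> 0\<close> have "f v \<noteq> 0" by (metis injD)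
  have "f ` P = range (\<lambda>c. \<sigma> c *s f v)"
    by (simp add: P_eq vec.span_singleton image_image f(2))
  also have "\<dots> = (\<lambda>d. d *s f v) ` range \<sigma>"
    by (simp add: image_image)
  also have "\<dots> = vec.span {f v}"
    using \<open>surj \<sigma>\<close> by (simp add: vec.span_singleton)
  finally show ?thesis using PG_points_span[OF \<open>f v \<noteq> 0\<close>] by simp
qed

text \<open>
  The embedding sends each element to the automorphism accompanying one of its representatives.
  It is injective because two elements with the same automorphism agree on a point.
\<close>

lemma singer_group_lepoll_field_automorphisms:
  fixes S :: "('a::field ^ 'n \<Rightarrow> 'a ^ 'n) set set"
  assumes roots: "\<And>p :: 'a poly. odd (degree p) \<Longrightarrow> \<exists>x. poly p x = 0"
    and odd: "odd CARD('n)"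
    and S: "singer_group S"
  shows "S \<lesssim> (field_automorphisms :: ('a \<Rightarrow> 'a) set)"
proof -
  define rep where "rep g f \<sigma> \<longleftrightarrow> f \<in> g \<and> bij f \<and> (\<forall>u v. f (u + v) = f u + f v) \<and>
      \<sigma> \<in> field_automorphisms \<and> (\<forall>c v. f (c *s v) = \<sigma> c *s f v)"
    for g and f :: "'a ^ 'n \<Rightarrow> 'a ^ 'n" and \<sigma>
  have "\<exists>\<sigma> f. rep g f \<sigma>" if "g \<in> S" for g
    using PGammaL_representative[OF singer_group_carrier[OF S that]] unfolding rep_def by metis
  then obtain \<sigma> where \<sigma>: "\<And>g. g \<in> S \<Longrightarrow> \<exists>f. rep g f (\<sigma> g)" by metis
  have "inj_on \<sigma> S"
  proof (rule inj_onI)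
    fix g g' assume g: "g \<in> S" "g' \<in> S" "\<sigma> g = \<sigma> g'"
    obtain f k where f: "rep g f (\<sigma> g)" and k: "rep g' k (\<sigma> g)"
      using \<sigma>[OF g(1)] \<sigma>[OF g(2)] g(3) by auto
    obtain P where P: "P \<in> PG_points" "f ` P = k ` P"
      by (rule semilinear_agree_on_point[OF roots odd, of f "\<sigma> g" k])
        (use f k in \<open>auto simp: rep_def bij_is_inj\<close>)
    have sub: "vec.subspace P" using P(1) by (simp add: PG_points_def)
    have act: "PGammaL_act g P = f ` P" "PGammaL_act g' P = k ` P"
      using PGammaL_act_eq[OF singer_group_carrier[OF S] _ sub] f k g(1,2)
      unfolding rep_def by blast+
    have "f ` P \<in> PG_points"
      using f P(1) by (intro semilinear_image_point[of f "\<sigma> g"]) (auto simp: rep_def bij_is_inj)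
    then show "g = g'"
      using P act by (intro singer_group_unique[OF S g(1,2) P(1)]) simp_all
  qed
  moreover have "\<sigma> ` S \<subseteq> field_automorphisms" using \<sigma> by (auto simp: rep_def)
  ultimately show ?thesis unfolding lepoll_def by blast
qed

text \<open>
  The points spanned by \<open>e\<^sub>i + a e\<^sub>j\<close>, for \<open>a\<close> in the field, are pairwise distinct, and
  by transitivity each of them is reached from a fixed point by some group element.
\<close>

lemma UNIV_lepoll_singer_group:
  fixes S :: "('a::field ^ 'n \<Rightarrow> 'a ^ 'n) set set"
  assumes S: "singer_group S" and card: "CARD('n) \<ge> 2"
  shows "(UNIV :: 'a set) \<lesssim> S"
proof -
  obtain i j :: 'n where ij: "i \<noteq> j"
    using card by (metis UNIV_I card_2_iff' ex_card subsetD)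
  define v where "v a = (axis i 1 + axis j a :: 'a ^ 'n)" for a
  define P where "P a = vec.span {v a}" for a
  have v_i: "v a $ i = 1" and v_j: "v a $ j = a" for a
    using ij by (simp_all add: v_def axis_def)
  have P: "P a \<in> PG_points" for a
    unfolding P_def by (rule PG_points_span) (metis v_i zero_index zero_neq_one)
  have P_inj: "a = b" if "P a = P b" for a b
  proof -
    have "v a \<in> vec.span {v b}" using that by (metis P_def insertI1 vec.span_base)
    then obtain c where c: "v a = c *s v b" by (auto simp: vec.span_singleton)
    have "c = 1" using arg_cong[OF c, of "\<lambda>w. w $ i"] by (simp add: v_i)
    then show ?thesis using arg_cong[OF c, of "\<lambda>w. w $ j"] by (simp add: v_j)
  qed
  have "\<exists>g\<in>S. PGammaL_act g (P 0) = P a" for a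
    using S P unfolding singer_group_def by metis
  then obtain g where g: "\<And>a. g a \<in> S" "\<And>a. PGammaL_act (g a) (P 0) = P a" by metis
  have "inj g" by (rule injI) (metis P_inj g(2))
  with g(1) show ?thesis unfolding lepoll_def by blast
qed

lemma no_singer_group:
  fixes S :: "('a::field ^ 'n \<Rightarrow> 'a ^ 'n) set set"
  assumes "\<And>p :: 'a poly. odd (degree p) \<Longrightarrow> \<exists>x. poly p x = 0"
    and "CARD('n) \<ge> 3" "odd CARD('n)"
    and small: "(field_automorphisms :: ('a \<Rightarrow> 'a) set) \<prec> (UNIV :: 'a set)"
  shows "\<not> singer_group S"
proof
  assume S: "singer_group S"
  have "(UNIV :: 'a set) \<lesssim> S"
    using assms(2) by (intro UNIV_lepoll_singer_group[OF S]) simp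
  also have "S \<lesssim> (field_automorphisms :: ('a \<Rightarrow> 'a) set)"
    by (rule singer_group_lepoll_field_automorphisms[OF assms(1,3) S])
  also note small
  finally show False by (simp add: lesspoll_def)
qed

section \<open>The real numbers\<close>

text \<open>
  A polynomial of odd degree takes values of opposite sign far to the left and far to the right.
\<close>

lemma real_poly_odd_root:
  fixes p :: "real poly"
  assumes odd: "odd (degree p)"
  shows "\<exists>x. poly p x = 0"
proof -
  have root: "\<exists>x. poly q x = 0" if q: "odd (degree q)" "lead_coeff q > 0" for q :: "real poly"
  proof -
    \<comment> \<open>Reflecting in the origin turns the behaviour of \<open>q\<close> at minus infinity into that of \<open>r\<close> at
      plus infinity, where positivity of the leading coefficient gives a lower bound.\<close>
    define r where "r = - (q \<circ>\<^sub>p [:0, -1:])"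
    have "lead_coeff r = lead_coeff q"
      using q(1) lead_coeff_comp[of "[:0, -1:]" q] by (simp add: r_def)
    then have "lead_coeff r > 0" using q(2) by simp
    then obtain m n where m: "\<And>x. x \<ge> m \<Longrightarrow> poly r x \<ge> lead_coeff r"
      and n: "\<And>x. x \<ge> n \<Longrightarrow> poly q x \<ge> lead_coeff q"
      using poly_pinfty_gt_lc[OF q(2)] poly_pinfty_gt_lc[of r] by metis
    define b where "b = max 1 (max m n)"
    have "m \<le> b" "n \<le> b" by (simp_all add: b_def)
    have "poly q b > 0" using n[OF \<open>n \<le> b\<close>] q(2) by simp
    moreover have "poly q (- b) < 0"
      using m[OF \<open>m \<le> b\<close>] \<open>lead_coeff r > 0\<close> by (simp add: r_def poly_pcompose)
    moreover have "- b < b" by (simp add: b_def)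
    ultimately show ?thesis using poly_IVT_pos by blast
  qed
  show ?thesis
  proof (cases "lead_coeff p > 0")
    case True
    then show ?thesis using root odd by blast
  next
    case False
    then have "lead_coeff (- p) > 0"
      using odd by (auto simp: not_less le_less)
    then show ?thesis using root[of "- p"] odd by simp
  qed
qed

text \<open>
  Every nonnegative real is a square, so an automorphism is monotone. It fixes the rationals,
  and a rational strictly between \<open>x\<close> and \<open>\<sigma> x\<close> would contradict monotonicity.
\<close>

lemma field_automorphism_real_eq_id:
  fixes \<sigma> :: "real \<Rightarrow> real"
  assumes "\<sigma> \<in> field_automorphisms"
  shows "\<sigma> = id"
proof
  fix x
  have zero: "\<sigma> 0 = 0" and one: "\<sigma> 1 = 1"
    and add: "\<And>x y. \<sigma> (x + y) = \<sigma> x + \<sigma> y" and mult: "\<And>x y. \<sigma> (x * y) = \<sigma> x * \<sigma> y"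
    using assms by (auto simp: field_automorphisms_def)
  have mono: "\<sigma> x \<le> \<sigma> y" if "x \<le> y" for x y
  proof -
    have "\<sigma> y = \<sigma> (x + sqrt (y - x) * sqrt (y - x))" using that by simp
    also have "\<dots> = \<sigma> x + \<sigma> (sqrt (y - x)) * \<sigma> (sqrt (y - x))"
      by (simp only: add mult)
    finally show ?thesis by simp
  qed
  have nat: "\<sigma> (of_nat n) = of_nat n" for n
    by (induction n) (simp_all add: zero one add)
  have minus: "\<sigma> (- y) = - \<sigma> y" for y
    using add[of y "- y"] zero by simp
  have int: "\<sigma> (of_int m) = of_int m" for m
    by (cases m rule: int_cases2) (simp_all add: nat minus)
  have rat: "\<sigma> q = q" if "q \<in> \<rat>" for q
  proof -
    obtain a b :: int where "b > 0" "coprime a b" "q = of_int a / of_int b"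
      by (rule Rats_cases'[OF \<open>q \<in> \<rat>\<close>])
    then have ab: "b \<noteq> 0" "q = of_int a / of_int b" by simp_all
    then have q: "q * of_int b = of_int a" by simp
    then have "\<sigma> q * of_int b = q * of_int b" by (metis int mult)
    with ab(1) show ?thesis by simp
  qed
  show "\<sigma> x = id x"
  proof (rule ccontr)
    assume "\<sigma> x \<noteq> id x"
    then consider "\<sigma> x < x" | "x < \<sigma> x" by fastforce
    then show False
    proof cases
      case 1
      then obtain q where "q \<in> \<rat>" "\<sigma> x < q" "q < x" using Rats_dense_in_real by blast
      then show False using mono[of q x] rat[of q] by simp
    next
      case 2
      then obtain q where "q \<in> \<rat>" "x < q" "q < \<sigma> x" using Rats_dense_in_real by blast
      then show False using mono[of x q] rat[of q] by simp
    qed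
  qed
qed

lemma field_automorphisms_real_lesspoll:
  "(field_automorphisms :: (real \<Rightarrow> real) set) \<prec> (UNIV :: real set)"
proof (rule finite_lesspoll_infinite)
  have "field_automorphisms \<subseteq> {id :: real \<Rightarrow> real}"
    using field_automorphism_real_eq_id by blast
  then show "finite (field_automorphisms :: (real \<Rightarrow> real) set)"
    by (rule finite_subset) simp
qed (rule infinite_UNIV_char_0)

section \<open>Nonexistence of Singer groups\<close>

theorem corollary7p2:
  shows "(real_closed TYPE('a::field) \<and> CARD('n::finite) \<ge> 3 \<and> odd CARD('n) \<and>
            (field_automorphisms :: ('a \<Rightarrow> 'a) set) \<prec> (UNIV :: 'a set)
          \<longrightarrow> \<not> (\<exists>S :: ('a ^ 'n \<Rightarrow> 'a ^ 'n) set set. singer_group S))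
       \<and> \<not> (\<exists>S :: (real ^ 3 \<Rightarrow> real ^ 3) set set. singer_group S)"
proof (intro conjI impI)
  assume "real_closed TYPE('a) \<and> CARD('n) \<ge> 3 \<and> odd CARD('n) \<and>
    (field_automorphisms :: ('a \<Rightarrow> 'a) set) \<prec> (UNIV :: 'a set)"
  then show "\<not> (\<exists>S :: ('a ^ 'n \<Rightarrow> 'a ^ 'n) set set. singer_group S)"
    using no_singer_group unfolding real_closed_def by blast
next
  have "\<not> singer_group S" for S :: "(real ^ 3 \<Rightarrow> real ^ 3) set set"
    by (rule no_singer_group[OF real_poly_odd_root _ _ field_automorphisms_real_lesspoll]) simp_all
  then show "\<not> (\<exists>S :: (real ^ 3 \<Rightarrow> real ^ 3) set set. singer_group S)" by blast
qed

end
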